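(* There is an $O(n)$-time algorithm for $R2|G=\mathrm{bipartite}|C_{\max}$ which, on every instance, returns a feasible schedule with makespan at most $2C^*_{\max}$.
   Context: Problem $R2|G=\mathrm{bipartite}|C_{\max}$: there are two unrelated machines $M_1,M_2$, jobs $J=\{J_1,\dots,J_n\}$ with natural-number processing times $p_{i,j}$ (the time of job $J_j$ on machine $M_i$, $i\in\{1,2\}$), and a bipartite incompatibility graph $G=(J,E)$. A feasible schedule assigns each job to exactly one machine so that the jobs on each machine form an independent set in $G$. The makespan is $\max_{i}\sum_{J_j\text{ assigned to }M_i}p_{i,j}$, and $C^*_{\max}$ is the minimum makespan over feasible schedules.
   Formalization: O(n) in the number of jobs is impossible if G is read edge by edge; proved instead: time O(n+|E|) on an additive RAM with adjacency lists, and O(n) when each job's neighbourhood is one n-bit word with unit-cost bitwise AND and leading-bit operations. *)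

theory Defs
  imports Complex_Main "HOL-Library.Landau_Symbols" "HOL-Library.Discrete_Functions"
begin

section \<open>The scheduling problem\<close>

definition simple_graph :: "'a set \<Rightarrow> 'a set set \<Rightarrow> bool" where
  "simple_graph V E \<longleftrightarrow> (\<forall>e\<in>E. e \<subseteq> V \<and> card e = 2)"

definition independent_set :: "'a set set \<Rightarrow> 'a set \<Rightarrow> bool" where
  "independent_set E S \<longleftrightarrow> (\<forall>e\<in>E. \<not> e \<subseteq> S)"

definition bipartite :: "'a set \<Rightarrow> 'a set set \<Rightarrow> bool" where
  "bipartite V E \<longleftrightarrow>
     (\<exists>A B. A \<union> B = V \<and> A \<inter> B = {} \<and> independent_set E A \<and> independent_set E B)"

text \<open>The jobs are \<open>0, \<dots>, n - 1\<close>, the machines are \<open>1\<close> and \<open>2\<close>, and \<open>p i j\<close> is the processing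
  time of job \<open>j\<close> on machine \<open>i\<close>. A schedule maps jobs to machines; its values outside
  \<open>{..<n}\<close> are irrelevant.\<close>

definition bipartite_instance :: "nat \<Rightarrow> nat set set \<Rightarrow> bool" where
  "bipartite_instance n E \<longleftrightarrow> simple_graph {..<n} E \<and> bipartite {..<n} E"

definition feasible :: "nat \<Rightarrow> nat set set \<Rightarrow> (nat \<Rightarrow> nat) \<Rightarrow> bool" where
  "feasible n E \<sigma> \<longleftrightarrow>
     (\<forall>j<n. \<sigma> j \<in> {1, 2}) \<and> (\<forall>i\<in>{1, 2}. independent_set E {j. j < n \<and> \<sigma> j = i})"

definition makespan :: "nat \<Rightarrow> (nat \<Rightarrow> nat \<Rightarrow> nat) \<Rightarrow> (nat \<Rightarrow> nat) \<Rightarrow> nat" where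
  "makespan n p \<sigma> = Max ((\<lambda>i. \<Sum>j | j < n \<and> \<sigma> j = i. p i j) ` {1, 2})"

definition opt_makespan :: "nat \<Rightarrow> nat set set \<Rightarrow> (nat \<Rightarrow> nat \<Rightarrow> nat) \<Rightarrow> nat" where
  "opt_makespan n E p = (LEAST C. \<exists>\<sigma>. feasible n E \<sigma> \<and> C = makespan n p \<sigma>)"

section \<open>Random access machine programs\<close>

text \<open>A unit-cost random access machine, programmed in a structured language. The memory consists
  of named arrays of natural numbers; a scalar variable is cell \<open>0\<close> of an array. \<open>Sub\<close> is
  truncated subtraction, and a test succeeds iff its value is nonzero. \<open>And\<close> (bitwise
  conjunction) and \<open>Log\<close> (position of the leading bit) are the word operations; programs that
  avoid them are programs of the classical additive machine.\<close>

type_synonym memory = "string \<Rightarrow> nat \<Rightarrow> nat"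

datatype exp =
    Const nat
  | Cell string exp
  | Add exp exp
  | Sub exp exp
  | And exp exp
  | Log exp

datatype com =
    Skip
  | Store string exp exp
  | Seq com com
  | Cond exp com com
  | While exp com

primrec eval :: "exp \<Rightarrow> memory \<Rightarrow> nat" where
  "eval (Const k) s = k"
| "eval (Cell a e) s = s a (eval e s)"
| "eval (Add e f) s = eval e s + eval f s"
| "eval (Sub e f) s = eval e s - eval f s"
| "eval (And e f) s = Bit_Operations.and (eval e s) (eval f s)"
| "eval (Log e) s = floor_log (eval e s)"

primrec cost :: "exp \<Rightarrow> nat" where
  "cost (Const k) = 1"
| "cost (Cell a e) = cost e + 1"
| "cost (Add e f) = cost e + cost f + 1"
| "cost (Sub e f) = cost e + cost f + 1"
| "cost (And e f) = cost e + cost f + 1"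
| "cost (Log e) = cost e + 1"

text \<open>\<open>exec c s t s'\<close>: started in memory \<open>s\<close>, the program \<open>c\<close> halts after exactly \<open>t\<close> steps in
  memory \<open>s'\<close>.\<close>

inductive exec :: "com \<Rightarrow> memory \<Rightarrow> nat \<Rightarrow> memory \<Rightarrow> bool" where
  Skip: "exec Skip s 1 s"
| Store: "exec (Store a e f) s (cost e + cost f + 1) (s(a := (s a)(eval e s := eval f s)))"
| Seq: "exec c s t s' \<Longrightarrow> exec d s' u s'' \<Longrightarrow> exec (Seq c d) s (t + u) s''"
| CondTrue: "eval e s \<noteq> 0 \<Longrightarrow> exec c s t s' \<Longrightarrow> exec (Cond e c d) s (cost e + 1 + t) s'"
| CondFalse: "eval e s = 0 \<Longrightarrow> exec d s t s' \<Longrightarrow> exec (Cond e c d) s (cost e + 1 + t) s'"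
| WhileFalse: "eval e s = 0 \<Longrightarrow> exec (While e c) s (cost e + 1) s"
| WhileTrue: "eval e s \<noteq> 0 \<Longrightarrow> exec c s t s' \<Longrightarrow> exec (While e c) s' u s'' \<Longrightarrow>
    exec (While e c) s (cost e + 1 + t + u) s''"

lemma exec_deterministic:
  "exec c s t s' \<Longrightarrow> exec c s u s'' \<Longrightarrow> u = t \<and> s'' = s'"
proof (induction arbitrary: u s'' rule: exec.induct)
  case (Skip s)
  from Skip.prems show ?case by cases auto
next
  case (Store a e f s)
  from Store.prems show ?case by cases auto
next
  case (Seq c s t s' d v s3)
  from Seq.prems show ?case by cases (use Seq.IH in blast)
next
  case (CondTrue e s c t s' d)
  from CondTrue.prems show ?case by cases (use CondTrue.IH CondTrue.hyps in blast)+
next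
  case (CondFalse e s d t s' c)
  from CondFalse.prems show ?case by cases (use CondFalse.IH CondFalse.hyps in blast)+
next
  case (WhileFalse e s c)
  from WhileFalse.prems show ?case by cases (use WhileFalse.hyps in blast)+
next
  case (WhileTrue e s c t s' v s3)
  from WhileTrue.prems show ?case by cases (use WhileTrue.IH WhileTrue.hyps in blast)+
qed

primrec additive_exp :: "exp \<Rightarrow> bool" where
  "additive_exp (Const k) = True"
| "additive_exp (Cell a e) = additive_exp e"
| "additive_exp (Add e f) = (additive_exp e \<and> additive_exp f)"
| "additive_exp (Sub e f) = (additive_exp e \<and> additive_exp f)"
| "additive_exp (And e f) = False"
| "additive_exp (Log e) = False"

primrec additive_com :: "com \<Rightarrow> bool" where
  "additive_com Skip = True"
| "additive_com (Store a e f) = (additive_exp e \<and> additive_exp f)"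
| "additive_com (Seq c d) = (additive_com c \<and> additive_com d)"
| "additive_com (Cond e c d) = (additive_exp e \<and> additive_com c \<and> additive_com d)"
| "additive_com (While e c) = (additive_exp e \<and> additive_com c)"

section \<open>Presentation of instances in memory\<close>

definition job_memory :: "nat \<Rightarrow> (nat \<Rightarrow> nat \<Rightarrow> nat) \<Rightarrow> memory" where
  "job_memory n p = (\<lambda>_ _. 0)
     (''n'' := (\<lambda>_. 0)(0 := n),
      ''p1'' := (\<lambda>j. if j < n then p 1 j else 0),
      ''p2'' := (\<lambda>j. if j < n then p 2 j else 0))"

text \<open>Reading a graph edge by edge takes time proportional to the number of edges, which need not be
  linear in the number of jobs. A presentation of the graph by one word per job is its
  adjacency matrix with every row stored as a bit vector: bit \<open>k\<close> of \<open>N[j]\<close> is set iff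
  \<open>j\<close> and \<open>k\<close> are incompatible.\<close>

definition matrix_memory :: "nat \<Rightarrow> nat set set \<Rightarrow> (nat \<Rightarrow> nat \<Rightarrow> nat) \<Rightarrow> memory" where
  "matrix_memory n E p = (job_memory n p)
     (''N'' := (\<lambda>j. \<Sum>k | k < n \<and> {j, k} \<in> E. 2 ^ k))"

text \<open>Adjacency lists, in an arbitrary order, are stored one after the other in \<open>adj\<close>; the list of
  job \<open>j\<close> occupies the cells \<open>off[j], \<dots>, off[j + 1] - 1\<close>.\<close>

definition adjacency_lists :: "nat \<Rightarrow> nat set set \<Rightarrow> (nat \<Rightarrow> nat list) \<Rightarrow> bool" where
  "adjacency_lists n E nb \<longleftrightarrow> (\<forall>j<n. distinct (nb j) \<and> set (nb j) = {k. {j, k} \<in> E})"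

definition list_memory :: "nat \<Rightarrow> (nat \<Rightarrow> nat list) \<Rightarrow> (nat \<Rightarrow> nat \<Rightarrow> nat) \<Rightarrow> memory" where
  "list_memory n nb p = (let adj = concat (map nb [0..<n]) in (job_memory n p)
     (''off'' := (\<lambda>j. if j \<le> n then \<Sum>i<j. length (nb i) else 0),
      ''adj'' := (\<lambda>k. if k < length adj then adj ! k else 0)))"

section \<open>Approximation algorithms\<close>

text \<open>The program halts after at most \<open>T\<close> steps, leaving in array \<open>out\<close> a feasible schedule whose
  makespan is at most \<open>\<rho>\<close> times the minimum.\<close>

definition approximates_within ::
  "nat \<Rightarrow> com \<Rightarrow> memory \<Rightarrow> nat \<Rightarrow> nat \<Rightarrow> nat set set \<Rightarrow> (nat \<Rightarrow> nat \<Rightarrow> nat) \<Rightarrow> bool" where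
  "approximates_within \<rho> P s T n E p \<longleftrightarrow>
     (\<exists>t s'. exec P s t s' \<and> t \<le> T \<and>
        feasible n E (s' ''out'') \<and> makespan n p (s' ''out'') \<le> \<rho> * opt_makespan n E p)"

end

theory Submission
  imports Defs
begin

text \<open>In a feasible schedule each connected component of the graph is scheduled in one of two ways,
  which differ by exchanging the machines. Choosing for every component the way with the smaller sum
  of processing times, over both machines, minimises the total processing time among all feasible
  schedules. The total is at least the makespan of the schedule found and at most twice the makespan
  of an optimal one. Breadth-first search finds the components in linear time: with adjacency lists
  every list is read once; with bit rows the unvisited neighbours of a job are the set bits of the
  conjunction of its row with the mask of unvisited jobs, and each of them is extracted only once.\<close>

section \<open>Timed weakest preconditions\<close>

text \<open>Neither paths nor components are defined. What the argument needs of a component is that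
  every feasible schedule restricted to it is one of two opposite colourings;
  \<open>rigid_on\<close> says this directly, and it spreads along each edge the search follows. The
  program never tests for conflicts: bipartiteness enters only through the existence of a feasible
  schedule, which forces the colouring found to be proper. Both time bounds come from one amortised
  analysis. The interface \<open>scans\<close> leaves open how neighbours are read; only the weight
  \<open>w v\<close> differs. It is the list length for adjacency lists and 0 for bit rows, which
  removes |E| from the bound. The weights in the potentials are sums of step counts of program
  fragments, partly rounded up.\<close>

definition wp :: "com \<Rightarrow> (nat \<Rightarrow> memory \<Rightarrow> bool) \<Rightarrow> memory \<Rightarrow> bool" where
  "wp c Q s \<longleftrightarrow> (\<exists>t s'. exec c s t s' \<and> Q t s')"

lemma wp_mono: "wp c Q s \<Longrightarrow> (\<And>t s'. Q t s' \<Longrightarrow> R t s') \<Longrightarrow> wp c R s"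
  unfolding wp_def by blast

lemma wp_Skip: "Q 1 s \<Longrightarrow> wp Skip Q s"
  unfolding wp_def using exec.Skip by blast

lemma wp_Store:
  "Q (cost e + cost f + 1) (s(a := (s a)(eval e s := eval f s))) \<Longrightarrow> wp (Store a e f) Q s"
  unfolding wp_def using exec.Store by blast

lemma wp_Seq: "wp c (\<lambda>t s'. wp d (\<lambda>u. Q (t + u)) s') s \<Longrightarrow> wp (Seq c d) Q s"
  unfolding wp_def using exec.Seq by blast

lemma wp_Cond:
  assumes "eval e s \<noteq> 0 \<Longrightarrow> wp c (\<lambda>t. Q (cost e + 1 + t)) s"
    and "eval e s = 0 \<Longrightarrow> wp d (\<lambda>t. Q (cost e + 1 + t)) s"
  shows "wp (Cond e c d) Q s"
  using assms exec.CondTrue exec.CondFalse unfolding wp_def by (cases "eval e s = 0") blast+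

text \<open>One potential yields both termination and running time: an iteration takes at least one
  step, so \<open>\<Phi>\<close> drops strictly, and its drops pay for all iterations. The closing
  \<open>cost e + 1\<close> is the failing last test. The ghost argument \<open>x\<close> carries
  what the memory does not show, such as the queue as a list.\<close>

lemma wp_While:
  assumes step: "\<And>x s. I x s \<Longrightarrow> eval e s \<noteq> 0 \<Longrightarrow>
      wp c (\<lambda>t s'. \<exists>y. I y s' \<and> cost e + 1 + t + \<Phi> y \<le> \<Phi> x) s"
    and "I x s"
  shows "wp (While e c) (\<lambda>t s'. \<exists>y. I y s' \<and> eval e s' = 0 \<and> t + \<Phi> y \<le> \<Phi> x + cost e + 1) s"
  using \<open>I x s\<close>
proof (induction "\<Phi> x" arbitrary: x s rule: less_induct)
  case less
  show ?case
  proof (cases "eval e s = 0")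
    case True
    then show ?thesis
      unfolding wp_def
      by (intro exI[of _ "cost e + 1"] exI[of _ s] conjI exI[of _ x])
        (use exec.WhileFalse less.prems in simp_all)
  next
    case False
    from step[OF less.prems False] obtain t s' y where y: "exec c s t s'" "I y s'"
      "cost e + 1 + t + \<Phi> y \<le> \<Phi> x" unfolding wp_def by blast
    then have "\<Phi> y < \<Phi> x" by linarith
    from less.hyps[OF this y(2)] obtain u s'' z where z: "exec (While e c) s' u s''" "I z s''"
      "eval e s'' = 0" "u + \<Phi> z \<le> \<Phi> y + cost e + 1" unfolding wp_def by blast
    have "exec (While e c) s (cost e + 1 + t + u) s''"
      by (rule exec.WhileTrue[OF False y(1) z(1)])
    moreover have "cost e + 1 + t + u + \<Phi> z \<le> \<Phi> x + cost e + 1" using y z by linarith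
    ultimately show ?thesis using z unfolding wp_def by blast
  qed
qed

section \<open>Schedules of minimum total processing time\<close>

locale job_graph =
  fixes n :: nat and E :: "nat set set" and p :: "nat \<Rightarrow> nat \<Rightarrow> nat"
  assumes bip: "bipartite_instance n E"
begin

lemma edge_bounds:
  assumes "{j, k} \<in> E" shows "j < n" "k < n" "j \<noteq> k"
proof -
  have "{j, k} \<subseteq> {..<n}" "card {j, k} = 2"
    using assms bip unfolding bipartite_instance_def simple_graph_def by blast+
  then show "j < n" "k < n" "j \<noteq> k" by auto
qed

lemma feasible_edge:
  assumes "feasible n E \<sigma>" "{j, k} \<in> E" shows "\<sigma> k = 3 - \<sigma> j" "\<sigma> j \<noteq> \<sigma> k"
proof -
  have jk: "j < n" "k < n" using edge_bounds assms by auto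
  then have v: "\<sigma> j \<in> {1,2}" "\<sigma> k \<in> {1,2}" using assms unfolding feasible_def by auto
  show ne: "\<sigma> j \<noteq> \<sigma> k"
  proof
    assume "\<sigma> j = \<sigma> k"
    then have "{j, k} \<subseteq> {i. i < n \<and> \<sigma> i = \<sigma> j}" using jk by auto
    then show False using assms v unfolding feasible_def independent_set_def by blast
  qed
  show "\<sigma> k = 3 - \<sigma> j" using ne v by auto
qed

lemma feasible_exists: "\<exists>\<sigma>. feasible n E \<sigma>"
proof -
  obtain A B where AB: "A \<union> B = {..<n}" "A \<inter> B = {}" "independent_set E A" "independent_set E B"
    using bip unfolding bipartite_instance_def bipartite_def by blast
  let ?\<sigma> = "\<lambda>j. if j \<in> A then 1 else 2 :: nat"
  have "{j. j < n \<and> ?\<sigma> j = 1} = A" "{j. j < n \<and> ?\<sigma> j = 2} = B" using AB by (auto split: if_splits)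
  then have "feasible n E ?\<sigma>" using AB unfolding feasible_def by simp
  then show ?thesis by blast
qed

text \<open>Closure under edges makes \<open>D\<close> a union of components, so a later component
  shares no edge with it. Costs are compared with restrictions of schedules of the whole graph, so
  \<open>D = {..<n}\<close> gives optimality among all feasible schedules.\<close>

definition optimal_on :: "nat set \<Rightarrow> (nat \<Rightarrow> nat) \<Rightarrow> bool" where
  "optimal_on D \<tau> \<longleftrightarrow>
     (\<forall>j k. {j, k} \<in> E \<longrightarrow> j \<in> D \<longrightarrow> k \<in> D \<and> \<tau> j \<noteq> \<tau> k) \<and>
     (\<forall>\<sigma>. feasible n E \<sigma> \<longrightarrow> (\<Sum>j\<in>D. p (\<tau> j) j) \<le> (\<Sum>j\<in>D. p (\<sigma> j) j))"

text \<open>Stands in for connectedness of \<open>K\<close>: only \<open>\<tau>\<close> and its opposite extend to feasible schedules.\<close>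

definition rigid_on :: "nat set \<Rightarrow> (nat \<Rightarrow> nat) \<Rightarrow> bool" where
  "rigid_on K \<tau> \<longleftrightarrow>
     (\<forall>\<sigma>. feasible n E \<sigma> \<longrightarrow> (\<forall>j\<in>K. \<sigma> j = \<tau> j) \<or> (\<forall>j\<in>K. \<sigma> j = 3 - \<tau> j))"

lemma optimal_on_cong: "(\<And>j. j \<in> D \<Longrightarrow> \<tau> j = \<tau>' j) \<Longrightarrow> optimal_on D \<tau> = optimal_on D \<tau>'"
proof -
  assume eq: "\<And>j. j \<in> D \<Longrightarrow> \<tau> j = \<tau>' j"
  have "(\<Sum>j\<in>D. p (\<tau> j) j) = (\<Sum>j\<in>D. p (\<tau>' j) j)" by (rule sum.cong) (simp_all add: eq)
  moreover have "(k \<in> D \<and> \<tau> j \<noteq> \<tau> k) = (k \<in> D \<and> \<tau>' j \<noteq> \<tau>' k)" if "j \<in> D" for j k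
    using eq that by metis
  ultimately show "optimal_on D \<tau> = optimal_on D \<tau>'" unfolding optimal_on_def by simp
qed

text \<open>The search step: every feasible schedule puts \<open>k\<close> on the machine opposite
  to that of \<open>j\<close>, so whichever alternative holds on \<open>K\<close> extends to
  \<open>k\<close>.\<close>

lemma rigid_on_insert:
  assumes "rigid_on K \<tau>" "j \<in> K" "{j, k} \<in> E" "\<tau> j \<in> {1, 2}" "k \<notin> K"
  shows "rigid_on (insert k K) (\<tau>(k := 3 - \<tau> j))"
  unfolding rigid_on_def
proof (intro allI impI)
  fix \<sigma> assume f: "feasible n E \<sigma>"
  have "\<sigma> k = 3 - \<sigma> j" using feasible_edge[OF f assms(3)] by simp
  then show "(\<forall>i\<in>insert k K. \<sigma> i = (\<tau>(k := 3 - \<tau> j)) i) \<or>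
      (\<forall>i\<in>insert k K. \<sigma> i = 3 - (\<tau>(k := 3 - \<tau> j)) i)"
    using assms f unfolding rigid_on_def by auto
qed

lemma rigid_on_singleton: "k < n \<Longrightarrow> rigid_on {k} (\<tau>(k := 1))"
  unfolding rigid_on_def
proof (intro allI impI)
  fix \<sigma> assume "k < n" "feasible n E \<sigma>"
  then have "\<sigma> k \<in> {1, 2}" unfolding feasible_def by blast
  then show "(\<forall>j\<in>{k}. \<sigma> j = (\<tau>(k := 1)) j) \<or> (\<forall>j\<in>{k}. \<sigma> j = 3 - (\<tau>(k := 1)) j)"
    by auto
qed

text \<open>By rigidity the cost of a feasible schedule on \<open>K\<close> is one of just two sums,
  and \<open>\<tau>'\<close> costs no more than either; costs on the disjoint sets \<open>D\<close>
  and \<open>K\<close> add up.\<close>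

lemma optimal_on_Un:
  assumes D: "optimal_on D \<tau>" and K: "rigid_on K \<tau>" and fin: "finite D" "finite K"
    and disj: "D \<inter> K = {}"
    and closed: "\<And>j k. {j, k} \<in> E \<Longrightarrow> j \<in> K \<Longrightarrow> k \<in> K"
    and val: "\<And>j. j \<in> K \<Longrightarrow> \<tau> j \<in> {1, 2}"
    and eqD: "\<And>j. j \<in> D \<Longrightarrow> \<tau>' j = \<tau> j"
    and eqK: "(\<forall>j\<in>K. \<tau>' j = \<tau> j) \<or> (\<forall>j\<in>K. \<tau>' j = 3 - \<tau> j)"
    and le: "(\<Sum>j\<in>K. p (\<tau>' j) j) \<le> (\<Sum>j\<in>K. p (\<tau> j) j)"
      "(\<Sum>j\<in>K. p (\<tau>' j) j) \<le> (\<Sum>j\<in>K. p (3 - \<tau> j) j)"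
  shows "optimal_on (D \<union> K) \<tau>'"
proof -
  have D': "optimal_on D \<tau>'" using D eqD optimal_on_cong by metis
  have ne: "\<tau>' j \<noteq> \<tau>' k" if e: "{j, k} \<in> E" and j: "j \<in> K" for j k
  proof -
    \<comment> \<open>Properness on \<open>K\<close> is inherited: a feasible schedule separates
      \<open>j\<close> and \<open>k\<close>, and on \<open>K\<close> it is \<open>\<tau>\<close> or
      its opposite.\<close>
    obtain \<sigma> where \<sigma>: "feasible n E \<sigma>" using feasible_exists by blast
    have k: "k \<in> K" using closed e j .
    have "\<tau> j \<noteq> \<tau> k"
      using K \<sigma> j k feasible_edge(2)[OF \<sigma> e] unfolding rigid_on_def by auto
    then show ?thesis using eqK j k val[OF j] val[OF k] by auto
  qed
  have cost: "(\<Sum>j\<in>K. p (\<tau>' j) j) \<le> (\<Sum>j\<in>K. p (\<sigma> j) j)" if "feasible n E \<sigma>" for \<sigma>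
  proof -
    have "(\<forall>j\<in>K. \<sigma> j = \<tau> j) \<or> (\<forall>j\<in>K. \<sigma> j = 3 - \<tau> j)" using K that unfolding rigid_on_def by blast
    then have "(\<Sum>j\<in>K. p (\<sigma> j) j) = (\<Sum>j\<in>K. p (\<tau> j) j) \<or>
        (\<Sum>j\<in>K. p (\<sigma> j) j) = (\<Sum>j\<in>K. p (3 - \<tau> j) j)" by auto
    then show ?thesis using le by auto
  qed
  show ?thesis
    unfolding optimal_on_def
  proof (intro conjI allI impI)
    fix j k assume "{j, k} \<in> E" "j \<in> D \<union> K"
    then show "k \<in> D \<union> K" "\<tau>' j \<noteq> \<tau>' k" using D' ne closed unfolding optimal_on_def by blast+
  next
    fix \<sigma> assume f: "feasible n E \<sigma>"
    have "(\<Sum>j\<in>D. p (\<tau>' j) j) \<le> (\<Sum>j\<in>D. p (\<sigma> j) j)" using D' f unfolding optimal_on_def by blast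
    then show "(\<Sum>j\<in>D \<union> K. p (\<tau>' j) j) \<le> (\<Sum>j\<in>D \<union> K. p (\<sigma> j) j)"
      using cost[OF f] fin disj by (simp add: sum.union_disjoint add_mono)
  qed
qed

section \<open>From minimum total time to makespan\<close>

lemma sum_loads:
  assumes "\<And>j. j < n \<Longrightarrow> \<sigma> j \<in> {1, 2}"
  shows "(\<Sum>j<n. p (\<sigma> j) j) = (\<Sum>j | j < n \<and> \<sigma> j = 1. p 1 j) + (\<Sum>j | j < n \<and> \<sigma> j = 2. p 2 j)"
proof -
  have u: "{..<n} = {j. j < n \<and> \<sigma> j = 1} \<union> {j. j < n \<and> \<sigma> j = 2}" using assms by blast
  have "(\<Sum>j<n. p (\<sigma> j) j) =
      (\<Sum>j | j < n \<and> \<sigma> j = 1. p (\<sigma> j) j) + (\<Sum>j | j < n \<and> \<sigma> j = 2. p (\<sigma> j) j)"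
    by (subst u, subst sum.union_disjoint) auto
  then show ?thesis by simp
qed

lemma optimal_on_approximates:
  assumes opt: "optimal_on {..<n} \<tau>" and val: "\<And>j. j < n \<Longrightarrow> \<tau> j \<in> {1, 2}"
  shows "feasible n E \<tau>" "makespan n p \<tau> \<le> 2 * opt_makespan n E p"
proof -
  show "feasible n E \<tau>"
    unfolding feasible_def independent_set_def
  proof (intro conjI allI impI ballI notI)
    fix i e assume e: "e \<in> E" "e \<subseteq> {j. j < n \<and> \<tau> j = i}"
    then have "card e = 2" using bip unfolding bipartite_instance_def simple_graph_def by blast
    then obtain j k where "e = {j, k}" by (auto simp: card_2_iff)
    moreover from this have "j < n" "\<tau> j = \<tau> k" using e by auto
    ultimately show False using e opt unfolding optimal_on_def by blast
  qed (use val in auto)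
  have "\<exists>C \<sigma>. feasible n E \<sigma> \<and> C = makespan n p \<sigma>" using feasible_exists by blast
  from LeastI_ex[OF this] obtain \<sigma> where
    \<sigma>: "feasible n E \<sigma>" "opt_makespan n E p = makespan n p \<sigma>"
    unfolding opt_makespan_def by blast
  have "makespan n p \<tau> \<le> (\<Sum>j<n. p (\<tau> j) j)"
    using sum_loads[of \<tau>] val unfolding makespan_def by simp
  also have "\<dots> \<le> (\<Sum>j<n. p (\<sigma> j) j)" using opt \<sigma> unfolding optimal_on_def by blast
  also have "\<dots> \<le> 2 * makespan n p \<sigma>"
    using sum_loads[of \<sigma>] \<sigma> unfolding makespan_def feasible_def by simp
  finally show "makespan n p \<tau> \<le> 2 * opt_makespan n E p" using \<sigma> by simp
qed

end


section \<open>Breadth-first colouring\<close>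

abbreviation var :: "string \<Rightarrow> exp" where
  "var x \<equiv> Cell x (Const 0)"

abbreviation assign :: "string \<Rightarrow> exp \<Rightarrow> com" (infix \<open>::=\<close> 62) where
  "x ::= e \<equiv> Store x (Const 0) e"

abbreviation seq :: "com \<Rightarrow> com \<Rightarrow> com" (infixr \<open>;;\<close> 61) where
  "c ;; d \<equiv> Seq c d"

text \<open>Array \<open>pw\<close> holds the powers of two and \<open>U\<close> the mask of unvisited jobs when the graph is given by
  bit rows. With adjacency lists \<open>pw\<close> is zero and the update of \<open>U\<close> has no effect.\<close>

definition enqueue :: com where
  "enqueue =
     Store ''out'' (var ''k'') (var ''c'') ;;
     Store ''q'' (var ''t'') (var ''k'') ;;
     ''t'' ::= Add (var ''t'') (Const 1) ;;
     ''U'' ::= Sub (var ''U'') (Cell ''pw'' (var ''k'')) ;;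
     Cond (Sub (var ''c'') (Const 1))
       (''a'' ::= Add (var ''a'') (Cell ''p2'' (var ''k'')) ;;
        ''b'' ::= Add (var ''b'') (Cell ''p1'' (var ''k'')))
       (''a'' ::= Add (var ''a'') (Cell ''p1'' (var ''k'')) ;;
        ''b'' ::= Add (var ''b'') (Cell ''p2'' (var ''k'')))"

text \<open>The search ends with \<open>h\<close> equal to the queue length, so counting
  \<open>h\<close> down visits just the current component, at a cost proportional to its
  size.\<close>

definition flip :: com where
  "flip = While (var ''h'')
     (''h'' ::= Sub (var ''h'') (Const 1) ;;
      Store ''out'' (Cell ''q'' (var ''h''))
        (Sub (Const 3) (Cell ''out'' (Cell ''q'' (var ''h'')))))"

definition bfs :: "com \<Rightarrow> com" where
  "bfs scan = While (Sub (var ''t'') (var ''h''))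
     (''v'' ::= Cell ''q'' (var ''h'') ;;
      ''h'' ::= Add (var ''h'') (Const 1) ;;
      ''c'' ::= Sub (Const 3) (Cell ''out'' (var ''v'')) ;;
      scan)"

definition explore :: "com \<Rightarrow> com" where
  "explore scan =
     ''c'' ::= Const 1 ;;
     ''k'' ::= var ''i'' ;;
     ''h'' ::= Const 0 ;;
     enqueue ;;
     bfs scan ;;
     Cond (Sub (var ''a'') (var ''b'')) flip Skip ;;
     ''t'' ::= Const 0 ;;
     ''a'' ::= Const 0 ;;
     ''b'' ::= Const 0"

text \<open>The machines being 1 and 2, a zero in \<open>out\<close> doubles as the mark of an
  unvisited job.\<close>

definition schedule :: "com \<Rightarrow> com" where
  "schedule scan = While (Sub (var ''n'') (var ''i''))
     (Cond (Cell ''out'' (var ''i'')) Skip (explore scan) ;;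
      ''i'' ::= Add (var ''i'') (Const 1))"

lemma wp_flip:
  assumes "s ''h'' 0 = length Q" "\<And>i. i < length Q \<Longrightarrow> s ''q'' i = Q ! i" "distinct Q"
  shows "wp flip (\<lambda>t s'. t \<le> 20 * length Q + 3 \<and> (\<forall>x. x \<notin> {''out'', ''h''} \<longrightarrow> s' x = s x) \<and>
    s' ''out'' = (\<lambda>j. if j \<in> set Q then 3 - s ''out'' j else s ''out'' j)) s"
proof -
  define I where "I r s' \<longleftrightarrow> r \<le> length Q \<and> s' ''h'' 0 = r \<and>
    (\<forall>x. x \<notin> {''out'', ''h''} \<longrightarrow> s' x = s x) \<and>
    s' ''out'' = (\<lambda>j. if j \<in> set (drop r Q) then 3 - s ''out'' j else s ''out'' j)" for r and s' :: memory
  have I0: "I (length Q) s" unfolding I_def using assms by simp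
  show ?thesis
    unfolding flip_def
  proof (rule wp_mono[OF wp_While[where I = I and \<Phi> = "\<lambda>r. 20 * r", OF _ I0]], goal_cases)
    case (1 r s')
    then obtain i where r: "r = Suc i" unfolding I_def by (cases r) auto
    then have i: "i < length Q" and s': "s' ''h'' 0 = Suc i" "s' ''q'' = s ''q''"
      and s'x: "\<And>x. x \<notin> {''out'', ''h''} \<Longrightarrow> s' x = s x"
      and out: "s' ''out'' = (\<lambda>j. if j \<in> set (drop r Q) then 3 - s ''out'' j else s ''out'' j)"
      using 1 unfolding I_def by auto
    have d: "drop i Q = Q ! i # drop r Q" using i r by (simp add: Cons_nth_drop_Suc)
    \<comment> \<open>Flipping twice would restore the old machine; distinctness of the queue
      excludes it.\<close>
    have nd: "Q ! i \<notin> set (drop r Q)" using distinct_drop[OF assms(3), of i] d by simp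
    show ?case
      apply (rule wp_Seq, rule wp_Store, rule wp_Store, rule exI[of _ i])
      using i s' s'x r out nd by (auto simp: I_def assms d fun_eq_iff)
  next
    case (2 t s')
    then show ?case unfolding I_def by auto
  qed
qed

context job_graph
begin

text \<open>The state while the component with job list \<open>Q\<close> is being coloured, the jobs in \<open>D\<close> being
  scheduled already: \<open>a\<close> and \<open>b\<close> are the total processing times of \<open>Q\<close> under the current colouring
  and under the opposite one. The memory \<open>m\<close> supplies the arrays that are never written.\<close>

definition search_state :: "memory \<Rightarrow> nat set \<Rightarrow> nat list \<Rightarrow> memory \<Rightarrow> bool" where
  "search_state m D Q s \<longleftrightarrow>
     (s ''n'' = m ''n'' \<and> s ''p1'' = m ''p1'' \<and> s ''p2'' = m ''p2'' \<and> s ''pw'' = m ''pw'' \<and>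
      s ''N'' = m ''N'' \<and> s ''off'' = m ''off'' \<and> s ''adj'' = m ''adj'') \<and>
     (D \<subseteq> {..<n} \<and> set Q \<subseteq> {..<n} \<and> D \<inter> set Q = {} \<and> distinct Q) \<and>
     (\<forall>j<n. s ''out'' j = 0 \<longleftrightarrow> j \<notin> D \<union> set Q) \<and> (\<forall>j<n. s ''out'' j \<le> 2) \<and>
     s ''t'' 0 = length Q \<and> (\<forall>i<length Q. s ''q'' i = Q ! i) \<and>
     s ''a'' 0 = (\<Sum>j\<in>set Q. p (s ''out'' j) j) \<and>
     s ''b'' 0 = (\<Sum>j\<in>set Q. p (3 - s ''out'' j) j) \<and>
     s ''U'' 0 = (\<Sum>j\<in>{..<n} - D - set Q. m ''pw'' j) \<and>
     optimal_on D (s ''out'') \<and> rigid_on (set Q) (s ''out'')"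

definition job_data :: "memory \<Rightarrow> bool" where
  "job_data m \<longleftrightarrow> m ''n'' 0 = n \<and> (\<forall>j<n. m ''p1'' j = p 1 j \<and> m ''p2'' j = p 2 j)"

section \<open>The search invariant and its preservation\<close>

lemma search_stateD:
  assumes "search_state m D Q s"
  shows "s ''n'' = m ''n''" "s ''p1'' = m ''p1''" "s ''p2'' = m ''p2''" "s ''pw'' = m ''pw''"
      "s ''N'' = m ''N''" "s ''off'' = m ''off''" "s ''adj'' = m ''adj''"
    and "D \<subseteq> {..<n}" "set Q \<subseteq> {..<n}" "D \<inter> set Q = {}" "distinct Q"
    and "\<forall>j<n. s ''out'' j = 0 \<longleftrightarrow> j \<notin> D \<union> set Q" "\<forall>j<n. s ''out'' j \<le> 2"
    and "s ''t'' 0 = length Q" "\<forall>i<length Q. s ''q'' i = Q ! i"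
    and "s ''a'' 0 = (\<Sum>j\<in>set Q. p (s ''out'' j) j)"
      "s ''b'' 0 = (\<Sum>j\<in>set Q. p (3 - s ''out'' j) j)"
    and "s ''U'' 0 = (\<Sum>j\<in>{..<n} - D - set Q. m ''pw'' j)"
    and "optimal_on D (s ''out'')" "rigid_on (set Q) (s ''out'')"
  using assms unfolding search_state_def by simp_all

text \<open>Frame rule: the scalars \<open>h\<close>, \<open>i\<close>, \<open>v\<close>,
  \<open>c\<close>, \<open>k\<close>, \<open>e\<close> and \<open>W\<close> lie outside the
  invariant, so assigning to them preserves it.\<close>

lemma search_state_cong:
  assumes "search_state m D Q s"
    and "\<And>x. x \<in> {''n'', ''p1'', ''p2'', ''pw'', ''N'', ''off'', ''adj'', ''out'', ''t'', ''q'',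
      ''a'', ''b'', ''U''} \<Longrightarrow> s' x = s x"
  shows "search_state m D Q s'"
proof -
  have "s' ''n'' = s ''n''" "s' ''p1'' = s ''p1''" "s' ''p2'' = s ''p2''" "s' ''pw'' = s ''pw''"
    "s' ''N'' = s ''N''" "s' ''off'' = s ''off''" "s' ''adj'' = s ''adj''" "s' ''out'' = s ''out''"
    "s' ''t'' = s ''t''" "s' ''q'' = s ''q''" "s' ''a'' = s ''a''" "s' ''b'' = s ''b''"
    "s' ''U'' = s ''U''"
    by (rule assms(2), simp)+
  then show ?thesis using assms(1) unfolding search_state_def by (elim conjE, intro conjI) (simp_all only:)
qed

lemma search_state_colour:
  assumes "search_state m D Q s" "j \<in> D \<union> set Q" shows "s ''out'' j \<in> {1, 2}"
proof -
  have "j < n" using search_stateD(8,9)[OF assms(1)] assms(2) by auto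
  then show ?thesis using search_stateD(12,13)[OF assms(1), rule_format, of j] assms(2) by fastforce
qed

lemma wp_enqueue:
  assumes st: "search_state m D Q s" and m: "job_data m"
    and k: "s ''k'' 0 = k" "k < n" "k \<notin> D" "k \<notin> set Q"
    and c: "s ''c'' 0 = c" "c \<in> {1, 2}"
    and rigid: "rigid_on (insert k (set Q)) ((s ''out'')(k := c))"
  shows "wp enqueue (\<lambda>t s'. t \<le> 50 \<and> search_state m D (Q @ [k]) s' \<and>
    (\<forall>x. x \<notin> {''out'', ''q'', ''t'', ''U'', ''a'', ''b''} \<longrightarrow> s' x = s x) \<and>
    (\<forall>j. j \<noteq> k \<longrightarrow> s' ''out'' j = s ''out'' j)) s"
proof -
  let ?o = "(s ''out'')(k := c)"
  note st' = search_stateD[OF st]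
  have mp: "m ''p1'' k = p 1 k" "m ''p2'' k = p 2 k" using m k unfolding job_data_def by auto
  have sums: "(\<Sum>j\<in>set Q. p (?o j) j) = s ''a'' 0" "(\<Sum>j\<in>set Q. p (3 - ?o j) j) = s ''b'' 0"
    unfolding st'(16,17) using k by (auto intro!: sum.cong)
  have a: "s ''a'' 0 + p c k = (\<Sum>j\<in>set (Q @ [k]). p (?o j) j)"
    and b: "s ''b'' 0 + p (3 - c) k = (\<Sum>j\<in>set (Q @ [k]). p (3 - ?o j) j)"
    using k unfolding sums[symmetric] by (simp_all add: add.commute)
  \<comment> \<open>\<open>k\<close> is still unvisited, so its entry of \<open>pw\<close> is a
    summand of \<open>U\<close> and truncated subtraction is exact; if \<open>pw\<close> is zero,
    both sides vanish.\<close>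
  have "{..<n} - D - set (Q @ [k]) = {..<n} - D - set Q - {k}" by auto
  then have U: "s ''U'' 0 - m ''pw'' k = (\<Sum>j\<in>{..<n} - D - set (Q @ [k]). m ''pw'' j)"
    unfolding st'(18) using k by (simp add: sum_diff1_nat)
  have opt: "optimal_on D ?o"
    by (rule iffD1[OF optimal_on_cong st'(19)]) (use k in auto)
  have q: "((s ''q'')(length Q := k)) i = (Q @ [k]) ! i" if "i < length (Q @ [k])" for i
    using that st'(15) by (auto simp: nth_append less_Suc_eq)
  have zero: "?o j = 0 \<longleftrightarrow> j \<notin> D \<union> set (Q @ [k])" "?o j \<le> 2" if "j < n" for j
    using st'(12,13)[rule_format, OF that] c by auto
  \<comment> \<open>Phrased by the resulting values only, so that one argument covers both branches
    on \<open>c\<close>.\<close>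
  have state: "search_state m D (Q @ [k]) s'"
    if out: "s' ''out'' = ?o" and "s' ''q'' = (s ''q'')(length Q := k)" "s' ''t'' 0 = length Q + 1"
      "s' ''U'' 0 = s ''U'' 0 - m ''pw'' k" "s' ''a'' 0 = s ''a'' 0 + p c k"
      "s' ''b'' 0 = s ''b'' 0 + p (3 - c) k"
      and eq: "\<forall>x. x \<notin> {''out'', ''q'', ''t'', ''U'', ''a'', ''b''} \<longrightarrow> s' x = s x" for s'
  proof -
    have "s' ''n'' = m ''n''" "s' ''p1'' = m ''p1''" "s' ''p2'' = m ''p2''" "s' ''pw'' = m ''pw''"
      "s' ''N'' = m ''N''" "s' ''off'' = m ''off''" "s' ''adj'' = m ''adj''"
      using eq st'(1-7) by simp_all
    then show ?thesis
      unfolding search_state_def that(1-6) a b U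
      using st'(8-11) k q zero opt rigid by (intro conjI) (simp_all del: fun_upd_apply)
  qed
  show ?thesis
    unfolding enqueue_def
    using k c mp
    by (intro wp_Seq wp_Store wp_Cond; intro conjI state) (auto simp: st'(1-7) st'(14))
qed

text \<open>\<open>D\<close> is closed under edges. Hence a neighbour that already has a machine
  lies in the queue, and masking out \<open>D\<close> in a bit row loses no neighbour.\<close>

lemma neighbour_not_done:
  assumes st: "search_state m D Q s" and v: "v \<in> set Q" "{v, k} \<in> E"
  shows "k \<notin> D"
proof
  assume "k \<in> D"
  then have "v \<in> D"
    using search_stateD(19)[OF st] v(2) unfolding optimal_on_def by (metis insert_commute)
  then show False using search_stateD(10)[OF st] v by blast
qed

text \<open>The machine of \<open>v\<close> survives, so the value stored once in \<open>c\<close>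
  stays right for all neighbours found by the same scan.\<close>

lemma wp_enqueue_neighbour:
  assumes st: "search_state m D Q s" and m: "job_data m"
    and v: "v \<in> set Q" "{v, k} \<in> E" and k: "k \<notin> set Q" "s ''k'' 0 = k"
    and c: "s ''c'' 0 = 3 - s ''out'' v"
  shows "wp enqueue (\<lambda>t s'. t \<le> 50 \<and> search_state m D (Q @ [k]) s' \<and>
    (\<forall>x. x \<notin> {''out'', ''q'', ''t'', ''U'', ''a'', ''b''} \<longrightarrow> s' x = s x) \<and>
    s' ''out'' v = s ''out'' v) s"
proof -
  note st' = search_stateD[OF st]
  have "k < n" using edge_bounds v by blast
  have "k \<notin> D" by (rule neighbour_not_done[OF st v])
  have col: "s ''out'' v \<in> {1, 2}" using search_state_colour[OF st] v by blast
  then have "3 - s ''out'' v \<in> {1, 2}" by auto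
  note enq = wp_enqueue[OF st m k(2) \<open>k < n\<close> \<open>k \<notin> D\<close> k(1) c this
    rigid_on_insert[OF st'(20) v col k(1)]]
  have "v \<noteq> k" using v(1) k(1) by blast
  then show ?thesis by (intro wp_mono[OF enq]) blast
qed

text \<open>The running time of a scan may be charged to the job scanned, with weight \<open>w\<close>, and to the jobs
  newly discovered.\<close>

definition scans :: "com \<Rightarrow> (nat \<Rightarrow> nat) \<Rightarrow> memory \<Rightarrow> bool" where
  "scans scan w m \<longleftrightarrow> (\<forall>D Q s v. search_state m D Q s \<longrightarrow> v \<in> set Q \<longrightarrow> s ''v'' 0 = v \<longrightarrow>
     s ''c'' 0 = 3 - s ''out'' v \<longrightarrow>
     wp scan (\<lambda>t s'. \<exists>R. search_state m D (Q @ R) s' \<and> {k. {v, k} \<in> E} \<subseteq> set (Q @ R) \<and>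
       s' ''h'' = s ''h'' \<and> s' ''i'' = s ''i'' \<and> t \<le> 100 * (1 + w v + length R)) s)"

lemma scansD:
  assumes "scans scan w m" "search_state m D Q s" "v \<in> set Q" "s ''v'' 0 = v"
    "s ''c'' 0 = 3 - s ''out'' v"
  shows "wp scan (\<lambda>t s'. \<exists>R. search_state m D (Q @ R) s' \<and> {k. {v, k} \<in> E} \<subseteq> set (Q @ R) \<and>
       s' ''h'' = s ''h'' \<and> s' ''i'' = s ''i'' \<and> t \<le> 100 * (1 + w v + length R)) s"
  by (rule assms(1)[unfolded scans_def, rule_format, OF assms(2-5)])

text \<open>\<open>\<Psi>\<close> reserves 124 per unit of \<open>1 + w j\<close> for a job still to
  be scanned and 100 for a job still to be discovered. The test and the three assignments before a
  scan take 24 steps and the scan at most 100 per unit, whence 124; the final 6 is the failing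
  test.\<close>

lemma wp_bfs:
  assumes scan: "scans scan w m" and st: "search_state m D Q s" and h: "s ''h'' 0 = 0"
  defines "\<Psi> \<equiv> \<lambda>Q h. 124 * (\<Sum>j\<in>{..<n} - D - set (take h Q). 1 + w j) + 100 * card ({..<n} - D - set Q)"
  shows "wp (bfs scan) (\<lambda>t s'. \<exists>Q'. search_state m D Q' s' \<and> set Q \<subseteq> set Q' \<and>
    s' ''h'' 0 = length Q' \<and> s' ''i'' = s ''i'' \<and>
    (\<forall>j\<in>set Q'. \<forall>k. {j, k} \<in> E \<longrightarrow> k \<in> set Q') \<and> t + \<Psi> Q' (length Q') \<le> \<Psi> Q 0 + 6) s"
proof -
  define I where "I = (\<lambda>(Q', h) s'. search_state m D Q' s' \<and> set Q \<subseteq> set Q' \<and>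
    s' ''h'' 0 = h \<and> h \<le> length Q' \<and> s' ''i'' = s ''i'' \<and>
    (\<forall>i<h. {k. {Q' ! i, k} \<in> E} \<subseteq> set Q'))"
  have I0: "I (Q, 0) s" unfolding I_def using st h by simp
  show ?thesis
    unfolding bfs_def
  proof (rule wp_mono[OF wp_While[where I = I and \<Phi> = "\<lambda>(Q, h). \<Psi> Q h", OF _ I0]], goal_cases)
    case (1 x r)
    obtain Q' h where x: "x = (Q', h)" by force
    have r: "search_state m D Q' r" "set Q \<subseteq> set Q'" "r ''h'' 0 = h" "r ''i'' = s ''i''"
      and nb: "\<And>i. i < h \<Longrightarrow> {k. {Q' ! i, k} \<in> E} \<subseteq> set Q'"
      using 1(1) unfolding I_def x by auto
    note r' = search_stateD[OF r(1)]
    have hQ: "h < length Q'" using 1(2) r r'(14) by simp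
    define v where "v = Q' ! h"
    have v: "v \<in> set Q'" "r ''q'' h = v" using hQ r'(15) unfolding v_def by auto
    define r1 where "r1 = r(''v'' := (r ''v'')(0 := v), ''h'' := (r ''h'')(0 := h + 1),
      ''c'' := (r ''c'')(0 := 3 - r ''out'' v))"
    have "search_state m D Q' r1" by (rule search_state_cong[OF r(1)]) (auto simp: r1_def)
    then have "wp scan (\<lambda>t s'. \<exists>R. search_state m D (Q' @ R) s' \<and> {k. {v, k} \<in> E} \<subseteq> set (Q' @ R) \<and>
       s' ''h'' = r1 ''h'' \<and> s' ''i'' = r1 ''i'' \<and> t \<le> 100 * (1 + w v + length R)) r1"
      by (rule scansD[OF scan _ v(1)]) (simp_all add: r1_def)
    then have "wp scan (\<lambda>t s'. \<exists>R. I (Q' @ R, Suc h) s' \<and> 24 + t + \<Psi> (Q' @ R) (Suc h) \<le> \<Psi> Q' h) r1"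
    proof (rule wp_mono)
      fix t s'
      assume "\<exists>R. search_state m D (Q' @ R) s' \<and> {k. {v, k} \<in> E} \<subseteq> set (Q' @ R) \<and>
       s' ''h'' = r1 ''h'' \<and> s' ''i'' = r1 ''i'' \<and> t \<le> 100 * (1 + w v + length R)"
      then obtain R where R: "search_state m D (Q' @ R) s'" "{k. {v, k} \<in> E} \<subseteq> set (Q' @ R)"
       "s' ''h'' = r1 ''h''" "s' ''i'' = r1 ''i''" "t \<le> 100 * (1 + w v + length R)" by blast
      note R' = search_stateD[OF R(1)]
      have nb': "{k. {(Q' @ R) ! i, k} \<in> E} \<subseteq> set (Q' @ R)" if "i < Suc h" for i
        using that nb[of i] R(2) hQ unfolding v_def by (cases "i = h") (auto simp: nth_append)
      have "I (Q' @ R, Suc h) s'"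
        unfolding I_def using R(1,3,4) r hQ nb' by (auto simp: r1_def)
      moreover
      have "take (Suc h) (Q' @ R) = take h Q' @ [v]" using hQ by (simp add: take_Suc_conv_app_nth v_def)
      then have "{..<n} - D - set (take (Suc h) (Q' @ R)) = {..<n} - D - set (take h Q') - {v}" by auto
      moreover have "v \<in> {..<n} - D - set (take h Q')"
      proof -
        have "v \<notin> set (take h Q')"
          using hQ r'(11) unfolding v_def by (auto simp: in_set_conv_nth nth_eq_iff_index_eq)
        then show ?thesis using v r'(9,10) by blast
      qed
      ultimately have "(\<Sum>j\<in>{..<n} - D - set (take h Q'). 1 + w j) =
          1 + w v + (\<Sum>j\<in>{..<n} - D - set (take (Suc h) (Q' @ R)). 1 + w j)"
        by (simp add: sum.remove[of _ v])
      moreover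
      have "{..<n} - D - set Q' = set R \<union> ({..<n} - D - set (Q' @ R))"
        using R'(9,10,11) by auto
      then have "card ({..<n} - D - set Q') = card (set R) + card ({..<n} - D - set (Q' @ R))"
        by (subst card_Un_disjoint[symmetric]) auto
      moreover have "card (set R) = length R" using R'(11) distinct_card by auto
      ultimately show "\<exists>R. I (Q' @ R, Suc h) s' \<and> 24 + t + \<Psi> (Q' @ R) (Suc h) \<le> \<Psi> Q' h"
        using \<open>I (Q' @ R, Suc h) s'\<close> R(5) unfolding \<Psi>_def by (intro exI[of _ R]) (auto simp: algebra_simps)
    qed
    then show ?case
      unfolding r1_def
      apply (intro wp_Seq wp_Store)
      apply (simp add: r v(2) x)
      apply (erule wp_mono)
      apply (elim exE)
      subgoal for t s' R by (rule exI[of _ "Q' @ R"], rule exI[of _ "Suc h"]) linarith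
      done
  next
    case (2 t s')
    then obtain Q' h where I: "I (Q', h) s'" and t: "t + \<Psi> Q' h \<le> \<Psi> Q 0 + 6"
      and ev: "s' ''t'' 0 - s' ''h'' 0 = 0" by auto
    then have s': "search_state m D Q' s'" "set Q \<subseteq> set Q'" "s' ''h'' 0 = h" "h \<le> length Q'"
      "s' ''i'' = s ''i''" "\<And>i. i < h \<Longrightarrow> {k. {Q' ! i, k} \<in> E} \<subseteq> set Q'" unfolding I_def by auto
    \<comment> \<open>The test is a truncated subtraction and gives only
      \<open>length Q' \<le> h\<close>; the invariant gives the converse.\<close>
    then have "h = length Q'" using ev search_stateD(14)[OF s'(1)] by simp
    moreover from this have "\<forall>j\<in>set Q'. \<forall>k. {j, k} \<in> E \<longrightarrow> k \<in> set Q'"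
      using s'(6) by (metis in_set_conv_nth mem_Collect_eq subsetD)
    ultimately show ?case using s' t by blast
  qed
qed

text \<open>\<open>a\<close> and \<open>b\<close> are the two sums that \<open>optimal_on_Un\<close>
  compares; after the conditional flip the component costs their minimum.\<close>

lemma search_state_finish:
  assumes st: "search_state m D Q s"
    and closed: "\<forall>j\<in>set Q. \<forall>k. {j, k} \<in> E \<longrightarrow> k \<in> set Q"
    and out: "s' ''out'' = (if s ''b'' 0 < s ''a'' 0
      then (\<lambda>j. if j \<in> set Q then 3 - s ''out'' j else s ''out'' j) else s ''out'')"
    and z: "s' ''t'' 0 = 0" "s' ''a'' 0 = 0" "s' ''b'' 0 = 0"
    and eq: "\<forall>x. x \<notin> {''out'', ''h'', ''t'', ''a'', ''b''} \<longrightarrow> s' x = s x"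
  shows "search_state m (D \<union> set Q) [] s'"
proof -
  note st' = search_stateD[OF st]
  have col: "s ''out'' j \<in> {1, 2}" if "j \<in> set Q" for j using search_state_colour[OF st] that by blast
  have flip: "(\<Sum>j\<in>set Q. p (s' ''out'' j) j) = min (s ''a'' 0) (s ''b'' 0)"
    unfolding out st'(16,17) by (auto simp: min_def intro!: sum.cong)
  have "optimal_on (D \<union> set Q) (s' ''out'')"
  proof (rule optimal_on_Un[OF st'(19,20)])
    show "finite D" using st'(8) finite_subset by blast
    show "s' ''out'' j = s ''out'' j" if "j \<in> D" for j using that st'(10) unfolding out by auto
  qed (use flip st'(10,16,17) closed col in \<open>auto simp: out\<close>)
  moreover have "rigid_on (set []) (s' ''out'')" unfolding rigid_on_def by simp
  moreover have "s' ''out'' j = 0 \<longleftrightarrow> j \<notin> D \<union> set Q" "s' ''out'' j \<le> 2" if "j < n" for j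
    using st'(12,13)[rule_format, OF that] col[of j] unfolding out by auto
  moreover have "s' ''U'' 0 = (\<Sum>j\<in>{..<n} - (D \<union> set Q) - set []. m ''pw'' j)"
    using eq st'(18) by (simp add: Diff_eq Int_assoc)
  moreover have "s' ''n'' = m ''n''" "s' ''p1'' = m ''p1''" "s' ''p2'' = m ''p2''" "s' ''pw'' = m ''pw''"
    "s' ''N'' = m ''N''" "s' ''off'' = m ''off''" "s' ''adj'' = m ''adj''"
    using eq st'(1-7) by simp_all
  ultimately show ?thesis
    unfolding search_state_def using z st'(8,9) by (intro conjI) auto
qed

text \<open>The weights of the search, with 20 more per job to pay for a later flip of its
  component.\<close>

definition potential :: "(nat \<Rightarrow> nat) \<Rightarrow> nat set \<Rightarrow> nat" where
  "potential w D = 124 * (\<Sum>j\<in>{..<n} - D. 1 + w j) + 120 * card ({..<n} - D)"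

text \<open>The 84 steps per component are 10 for the initial assignments, 50 for enqueuing
  \<open>i\<close>, 6 for the last test of the search, and 18 for the comparison, the last test of
  \<open>flip\<close> and the resets.\<close>

lemma wp_explore:
  assumes scan: "scans scan w m" and st: "search_state m D [] s" and m: "job_data m"
    and i: "s ''i'' 0 = i" "i < n" "i \<notin> D"
  shows "wp (explore scan) (\<lambda>t s'. \<exists>D'. search_state m D' [] s' \<and> D \<subseteq> D' \<and> i \<in> D' \<and>
    s' ''i'' = s ''i'' \<and> t + potential w D' \<le> potential w D + 84) s"
proof -
  define s1 where "s1 = s(''c'' := (s ''c'')(0 := 1), ''k'' := (s ''k'')(0 := i), ''h'' := (s ''h'')(0 := 0))"
  have s1: "search_state m D [] s1" by (rule search_state_cong[OF st]) (auto simp: s1_def)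
  have "wp enqueue (\<lambda>t s'. t \<le> 50 \<and> search_state m D ([] @ [i]) s' \<and>
    (\<forall>x. x \<notin> {''out'', ''q'', ''t'', ''U'', ''a'', ''b''} \<longrightarrow> s' x = s1 x) \<and>
    (\<forall>j. j \<noteq> i \<longrightarrow> s' ''out'' j = s1 ''out'' j)) s1"
    by (rule wp_enqueue[OF s1 m _ i(2,3)]) (use rigid_on_singleton[OF i(2)] in \<open>auto simp: s1_def\<close>)
  then have enq: "wp enqueue (\<lambda>t s'. t \<le> 50 \<and> search_state m D [i] s' \<and> s' ''h'' 0 = 0 \<and> s' ''i'' = s ''i'') s1"
    by (rule wp_mono) (auto simp: s1_def)
  let ?f = "\<lambda>Q h. 124 * (\<Sum>j\<in>{..<n} - D - set (take h Q). 1 + w j) + 100 * card ({..<n} - D - set Q)"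
  have final: "wp (Cond (Sub (var ''a'') (var ''b'')) flip Skip ;;
       ''t'' ::= Const 0 ;; ''a'' ::= Const 0 ;; ''b'' ::= Const 0)
      (\<lambda>t s'. search_state m (D \<union> set Q) [] s' \<and> s' ''i'' = s2 ''i'' \<and> t \<le> 20 * length Q + 18) s2"
    if s2: "search_state m D Q s2" "s2 ''h'' 0 = length Q"
      "\<forall>j\<in>set Q. \<forall>k. {j, k} \<in> E \<longrightarrow> k \<in> set Q" for Q s2
  proof -
    note s2' = search_stateD[OF s2(1)]
    show ?thesis
    proof (intro wp_Seq wp_Cond, goal_cases)
      case 1
      show ?case
      proof (rule wp_mono[OF wp_flip[of s2 Q]], goal_cases)
        case (4 t s3)
        then show ?case
          apply (intro wp_Seq wp_Store conjI)
            apply (rule search_state_finish[OF s2(1,3)])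
          using 1 by auto
      qed (use s2 s2'(11,15) in auto)
    next
      case 2
      then show ?case
        apply (intro wp_Seq wp_Store wp_Skip conjI)
          apply (rule search_state_finish[OF s2(1,3)])
        by auto
    qed
  qed
  have pot: "?f [i] 0 + 20 * length Q + potential w (D \<union> set Q) \<le> potential w D + ?f Q (length Q)"
    if "search_state m D Q s'" for Q s'
  proof -
    note s' = search_stateD[OF that]
    have "card ({..<n} - D - {i}) \<le> card ({..<n} - D)" by (rule card_mono) auto
    moreover have "{..<n} - D = set Q \<union> ({..<n} - D - set Q)" using s'(9,10) by auto
    then have "card ({..<n} - D) = card (set Q) + card ({..<n} - D - set Q)"
      by (subst card_Un_disjoint[symmetric]) auto
    moreover have "card (set Q) = length Q" using s'(11) distinct_card by auto
    moreover have "{..<n} - (D \<union> set Q) = {..<n} - D - set Q" by auto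
    ultimately show ?thesis unfolding potential_def by simp
  qed
  have "wp (enqueue ;; bfs scan ;; Cond (Sub (var ''a'') (var ''b'')) flip Skip ;;
       ''t'' ::= Const 0 ;; ''a'' ::= Const 0 ;; ''b'' ::= Const 0)
     (\<lambda>t s'. \<exists>D'. search_state m D' [] s' \<and> D \<subseteq> D' \<and> i \<in> D' \<and> s' ''i'' = s ''i'' \<and>
       t + potential w D' \<le> potential w D + 74) s1"
  proof (rule wp_Seq, rule wp_mono[OF enq], elim conjE, rule wp_Seq, rule wp_mono,
      rule wp_bfs[OF scan], assumption+, goal_cases)
    case (1 t s2 u s3)
    then obtain Q where Q: "search_state m D Q s3" "i \<in> set Q" "s3 ''h'' 0 = length Q"
      "s3 ''i'' = s ''i''" "\<forall>j\<in>set Q. \<forall>k. {j, k} \<in> E \<longrightarrow> k \<in> set Q"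
      "u + ?f Q (length Q) \<le> ?f [i] 0 + 6" by auto
    show ?case
      by (rule wp_mono[OF final[OF Q(1,3,5)]], rule exI[of _ "D \<union> set Q"])
        (use Q(2,4,6) \<open>t \<le> 50\<close> pot[OF Q(1)] in auto)
  qed
  then show ?thesis
    unfolding explore_def s1_def
    apply -
    apply (rule wp_Seq, rule wp_Store)+
    apply (simp add: i)
    apply (erule wp_mono)
    by fastforce
qed

text \<open>An iteration spends 16 steps outside \<open>explore\<close> and at most 84 inside it
  beyond the drop of \<open>potential\<close>, hence 100. In total a job accounts for 100 + 124 +
  120 steps and a unit of weight for 124, both rounded up to 400.\<close>

lemma wp_schedule:
  assumes scan: "scans scan w m" and st: "search_state m {} [] s" and m: "job_data m"
    and i: "s ''i'' 0 = 0"
  shows "wp (schedule scan) (\<lambda>t s'. t \<le> 400 * (n + (\<Sum>j<n. w j) + 1) \<and>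
    feasible n E (s' ''out'') \<and> makespan n p (s' ''out'') \<le> 2 * opt_makespan n E p) s"
proof -
  define I where "I = (\<lambda>(D, i) s'. search_state m D [] s' \<and> s' ''i'' 0 = i \<and> i \<le> n \<and> {..<i} \<subseteq> D)"
  have I0: "I ({}, 0) s" unfolding I_def using st i by simp
  show ?thesis
    unfolding schedule_def
  proof (rule wp_mono[OF wp_While[where I = I and
          \<Phi> = "\<lambda>(D, i). 100 * (n - i) + potential w D", OF _ I0]], goal_cases)
    case (1 x r)
    obtain D i where x: "x = (D, i)" by force
    have r: "search_state m D [] r" "r ''i'' 0 = i" "{..<i} \<subseteq> D"
      using 1(1) unfolding I_def x by auto
    note r' = search_stateD[OF r(1)]
    have i: "i < n" using 1(2) r(2) r'(1) m unfolding job_data_def by simp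
    have out: "r ''out'' i = 0 \<longleftrightarrow> i \<notin> D" using r'(12) i by simp
    \<comment> \<open>Common tail of both branches; a job scheduled earlier is the case
      \<open>D' = D\<close>, \<open>t = 1\<close>.\<close>
    have fin: "wp (''i'' ::= Add (var ''i'') (Const 1))
        (\<lambda>u s'. \<exists>y. I y s' \<and> cost (Sub (var ''n'') (var ''i'')) + 1 +
            (cost (Cell ''out'' (var ''i'')) + 1 + t + u) +
            (case y of (D, i) \<Rightarrow> 100 * (n - i) + potential w D)
          \<le> (case x of (D, i) \<Rightarrow> 100 * (n - i) + potential w D)) s'"
      if s': "search_state m D' [] s'" "D \<subseteq> D'" "i \<in> D'" "s' ''i'' = r ''i''"
        "t + potential w D' \<le> potential w D + 84" for t s' D'
    proof (rule wp_Store, rule exI[of _ "(D', Suc i)"], intro conjI)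
      have "{..<Suc i} \<subseteq> D'" using s'(2,3) r(3) by (auto simp: less_Suc_eq)
      moreover have "search_state m D' [] (s'(''i'' := (s' ''i'')(0 := Suc i)))"
        by (rule search_state_cong[OF s'(1)]) auto
      ultimately show "I (D', Suc i) (s'(''i'' := (s' ''i'')(eval (Const 0) s' := eval (Add (var ''i'') (Const 1)) s')))"
        unfolding I_def using i s'(4) r(2) by simp
    qed (use s'(5) i in \<open>auto simp: x\<close>)
    show ?case
    proof (rule wp_Seq, rule wp_Cond, goal_cases)
      case 1
      then have "i \<in> D" using out r by simp
      then show ?case
        by (intro wp_Skip fin[OF r(1)]) auto
    next
      case 2
      then have "i \<notin> D" using out r by simp
      show ?case
        by (rule wp_mono[OF wp_explore[OF scan r(1) m r(2) i \<open>i \<notin> D\<close>]], elim exE conjE)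
          (rule fin)
    qed
  next
    case (2 t s')
    then obtain D i where I: "I (D, i) s'" and t: "t + potential w D \<le> 100 * n + potential w {} + 6"
      and ev: "s' ''n'' 0 - s' ''i'' 0 = 0" by fastforce
    then have s': "search_state m D [] s'" "s' ''i'' 0 = i" "i \<le> n" "{..<i} \<subseteq> D" unfolding I_def by auto
    have "i = n" using ev s'(2,3) search_stateD(1)[OF s'(1)] m unfolding job_data_def by simp
    then have D: "D = {..<n}" using s'(4) search_stateD(8)[OF s'(1)] by blast
    have "t \<le> 400 * (n + (\<Sum>j<n. w j) + 1)"
      using t unfolding potential_def by (simp add: sum_Suc)
    moreover have "optimal_on {..<n} (s' ''out'')" using search_stateD(19)[OF s'(1)] D by simp
    ultimately show ?case
      using optimal_on_approximates search_state_colour[OF s'(1)] D by simp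
  qed
qed

end

section \<open>Adjacency lists\<close>

definition scan_lists :: com where
  "scan_lists =
     ''e'' ::= Cell ''off'' (var ''v'') ;;
     While (Sub (Cell ''off'' (Add (var ''v'') (Const 1))) (var ''e''))
       (''k'' ::= Cell ''adj'' (var ''e'') ;;
        Cond (Cell ''out'' (var ''k'')) Skip enqueue ;;
        ''e'' ::= Add (var ''e'') (Const 1))"

lemma additive_schedule_scan_lists: "additive_com (schedule scan_lists)"
  unfolding schedule_def explore_def bfs_def flip_def enqueue_def scan_lists_def by simp

section \<open>Layout and total length of adjacency lists\<close>

lemma length_concat_map_upt: "length (concat (map nb [0..<n])) = (\<Sum>i<n. length (nb i))"
  by (induction n) auto

lemma nth_concat_map_upt:
  assumes "j < n" "r < length (nb j)"
  shows "(\<Sum>i<j. length (nb i)) + r < length (concat (map nb [0..<n]))"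
    and "concat (map nb [0..<n]) ! ((\<Sum>i<j. length (nb i)) + r) = nb j ! r"
proof -
  have "(\<Sum>i<j. length (nb i)) + r < length (concat (map nb [0..<n])) \<and>
    concat (map nb [0..<n]) ! ((\<Sum>i<j. length (nb i)) + r) = nb j ! r"
    using assms
  proof (induction n)
    case (Suc n)
    show ?case
    proof (cases "j = n")
      case True
      then show ?thesis using Suc.prems
        by (simp add: nth_append length_concat_map_upt del: length_concat)
    next
      case False
      then show ?thesis using Suc by (auto simp: nth_append)
    qed
  qed simp
  then show "(\<Sum>i<j. length (nb i)) + r < length (concat (map nb [0..<n]))"
    and "concat (map nb [0..<n]) ! ((\<Sum>i<j. length (nb i)) + r) = nb j ! r" by auto
qed

context job_graph
begin

text \<open>Handshake argument: interchanging the sums counts each edge once for each of its two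
  ends.\<close>

lemma sum_length_adjacency_lists:
  assumes "adjacency_lists n E nb"
  shows "(\<Sum>j<n. length (nb j)) \<le> 2 * card E"
proof -
  have E: "e \<subseteq> {..<n}" "card e = 2" if "e \<in> E" for e
    using that bip unfolding bipartite_instance_def simple_graph_def by blast+
  have "E \<subseteq> Pow {..<n}" using E by blast
  then have fin: "finite E" using finite_subset by blast
  have "(\<Sum>j<n. length (nb j)) \<le> (\<Sum>j<n. card {e \<in> E. j \<in> e})"
  proof (rule sum_mono)
    fix j assume "j \<in> {..<n}"
    then have "distinct (nb j)" "set (nb j) = {k. {j, k} \<in> E}"
      using assms unfolding adjacency_lists_def by auto
    then have "length (nb j) = card {k. {j, k} \<in> E}" using distinct_card by metis
    also have "\<dots> \<le> card {e \<in> E. j \<in> e}"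
      by (rule card_inj_on_le[of "\<lambda>k. {j, k}"]) (use fin in \<open>auto simp: inj_on_def doubleton_eq_iff\<close>)
    finally show "length (nb j) \<le> card {e \<in> E. j \<in> e}" .
  qed
  also have "\<dots> = (\<Sum>j<n. \<Sum>e | e \<in> E \<and> j \<in> e. 1)" by simp
  also have "\<dots> = (\<Sum>e\<in>E. \<Sum>j | j \<in> {..<n} \<and> j \<in> e. 1)" by (rule sum.swap_restrict) (use fin in auto)
  also have "\<dots> = (\<Sum>e\<in>E. 2)"
  proof (rule sum.cong)
    fix e assume "e \<in> E"
    then have "{j. j \<in> {..<n} \<and> j \<in> e} = e" using E(1) by blast
    then show "(\<Sum>j | j \<in> {..<n} \<and> j \<in> e. 1) = (2::nat)" using E(2)[OF \<open>e \<in> E\<close>] by simp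
  qed simp
  finally show ?thesis by simp
qed

text \<open>Each list entry pays for a possible enqueuing: test and fetch 14, branch 4,
  \<open>enqueue\<close> at most 50, increment 6, rounded up to 80.\<close>

lemma scans_scan_lists:
  assumes m: "job_data m" and nb: "adjacency_lists n E nb"
    and off: "\<And>j. j \<le> n \<Longrightarrow> m ''off'' j = (\<Sum>i<j. length (nb i))"
    and adj: "\<And>j r. j < n \<Longrightarrow> r < length (nb j) \<Longrightarrow> m ''adj'' ((\<Sum>i<j. length (nb i)) + r) = nb j ! r"
  shows "scans scan_lists (\<lambda>j. length (nb j)) m"
  unfolding scans_def
proof (intro allI impI)
  fix D Q s v
  assume st: "search_state m D Q s" and v: "v \<in> set Q" and sv: "s ''v'' 0 = v"
    and c: "s ''c'' 0 = 3 - s ''out'' v"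
  note st' = search_stateD[OF st]
  have vn: "v < n" using v st'(9) by blast
  have nbv: "set (nb v) = {k. {v, k} \<in> E}" using nb vn unfolding adjacency_lists_def by blast
  define base where "base = (\<Sum>i<v. length (nb i))"
  have base: "m ''off'' v = base" "m ''off'' (Suc v) = base + length (nb v)" using off vn unfolding base_def by auto
  define I where "I = (\<lambda>(R, r) s'. search_state m D (Q @ R) s' \<and> r \<le> length (nb v) \<and>
    s' ''e'' 0 = base + r \<and> set (take r (nb v)) \<subseteq> set (Q @ R) \<and>
    s' ''v'' = s ''v'' \<and> s' ''c'' = s ''c'' \<and> s' ''h'' = s ''h'' \<and> s' ''i'' = s ''i'' \<and>
    s' ''out'' v = s ''out'' v)"
  define s1 where "s1 = s(''e'' := (s ''e'')(0 := base))"
  have "search_state m D Q s1" by (rule search_state_cong[OF st]) (auto simp: s1_def)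
  then have I0: "I ([], 0) s1" unfolding I_def by (simp add: s1_def)
  show "wp scan_lists (\<lambda>t s'. \<exists>R. search_state m D (Q @ R) s' \<and> {k. {v, k} \<in> E} \<subseteq> set (Q @ R) \<and>
       s' ''h'' = s ''h'' \<and> s' ''i'' = s ''i'' \<and> t \<le> 100 * (1 + length (nb v) + length R)) s"
    unfolding scan_lists_def
  proof (rule wp_Seq, rule wp_Store, rule wp_mono[OF wp_While[where I = I and
          \<Phi> = "\<lambda>(R, r). 80 * (length (nb v) - r)", of _ _ "([], 0)"]], goal_cases)
    case (1 x r0)
    obtain R r where x: "x = (R, r)" by force
    have r0: "search_state m D (Q @ R) r0" "r0 ''e'' 0 = base + r" "set (take r (nb v)) \<subseteq> set (Q @ R)"
      "r0 ''v'' = s ''v''" "r0 ''c'' = s ''c''" "r0 ''h'' = s ''h''" "r0 ''i'' = s ''i''"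
      "r0 ''out'' v = s ''out'' v" using 1(1) unfolding I_def x by auto
    note r0' = search_stateD[OF r0(1)]
    have r: "r < length (nb v)" using 1(2) r0 r0'(6) sv base by simp
    define k where "k = nb v ! r"
    have k: "m ''adj'' (base + r) = k" "{v, k} \<in> E"
      using adj[OF vn r] nth_mem[OF r] nbv unfolding base_def k_def by auto
    define r1 where "r1 = r0(''k'' := (r0 ''k'')(0 := k))"
    have r1: "search_state m D (Q @ R) r1" by (rule search_state_cong[OF r0(1)]) (auto simp: r1_def)
    have r1x: "r1 ''e'' 0 = base + r" "r1 ''v'' = s ''v''" "r1 ''c'' = s ''c''" "r1 ''h'' = s ''h''"
      "r1 ''i'' = s ''i''" "r1 ''out'' v = s ''out'' v" "r1 ''k'' 0 = k" using r0 by (auto simp: r1_def)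
    have vQ: "v \<in> set (Q @ R)" using v by simp
    have step: "wp (''e'' ::= Add (var ''e'') (Const 1))
        (\<lambda>u s'. \<exists>y. I y s' \<and> 14 + (4 + t + u) + (case y of (R, r) \<Rightarrow> 80 * (length (nb v) - r))
          \<le> 80 * (length (nb v) - r)) s'"
      if s': "search_state m D (Q @ R') s'" "set R \<subseteq> set R'" "k \<in> set (Q @ R')" "t \<le> 50"
        and eq: "\<forall>x. x \<notin> {''out'', ''q'', ''t'', ''U'', ''a'', ''b''} \<longrightarrow> s' x = r1 x"
        and out: "s' ''out'' v = s ''out'' v" for t s' R'
    proof (rule wp_Store, rule exI[of _ "(R', Suc r)"], intro conjI)
      have "search_state m D (Q @ R') (s'(''e'' := (s' ''e'')(0 := base + Suc r)))"
        by (rule search_state_cong[OF s'(1)]) auto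
      moreover have "set (take (Suc r) (nb v)) \<subseteq> set (Q @ R')"
        using r0(3) s'(2,3) r by (auto simp: take_Suc_conv_app_nth k_def)
      ultimately show "I (R', Suc r)
          (s'(''e'' := (s' ''e'')(eval (Const 0) s' := eval (Add (var ''e'') (Const 1)) s')))"
        unfolding I_def using r eq out r1x by simp
    qed (use s'(4) r in auto)
    have "wp (Cond (Cell ''out'' (var ''k'')) Skip enqueue ;; ''e'' ::= Add (var ''e'') (Const 1))
        (\<lambda>u s'. \<exists>y. I y s' \<and> 14 + u + (case y of (R, r) \<Rightarrow> 80 * (length (nb v) - r))
          \<le> 80 * (length (nb v) - r)) r1"
    proof (rule wp_Seq, rule wp_Cond, goal_cases)
      case 1
      then have "k \<in> D \<union> set (Q @ R)"
        using search_stateD(12)[OF r1] edge_bounds(2)[OF k(2)] r1x by simp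
      then have "k \<in> set (Q @ R)" using neighbour_not_done[OF r1 vQ k(2)] by blast
      show ?case
        by (rule wp_Skip, rule wp_mono[OF step[OF r1 _ \<open>k \<in> set (Q @ R)\<close>, of 1]]) (use r1x in auto)
    next
      case 2
      then have "k \<notin> set (Q @ R)"
        using search_stateD(12)[OF r1] edge_bounds(2)[OF k(2)] r1x by simp
      have c1: "r1 ''c'' 0 = 3 - r1 ''out'' v" using c r1x by simp
      show ?case
        by (rule wp_mono[OF wp_enqueue_neighbour[OF r1 m vQ k(2) \<open>k \<notin> set (Q @ R)\<close> r1x(7) c1]],
            rule wp_mono[OF step[of "R @ [k]"]]) (use r1x in auto)
    qed
    moreover have "r0(''k'' := (r0 ''k'')(eval (Const 0) r0 := eval (Cell ''adj'' (var ''e'')) r0)) = r1"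
      unfolding r1_def by (simp add: r0(2) r0'(7) k)
    ultimately show ?case
      by (intro wp_Seq[OF wp_Store]) (simp only:, erule wp_mono, elim exE conjE,
          rule exI, rule conjI, assumption, simp add: x)
  next
    case 2
    then show ?case using I0 st'(6) sv base by (simp add: s1_def)
  next
    case (3 t s')
    then obtain R r where I: "I (R, r) s'" and t: "t \<le> 80 * length (nb v) + 9"
      and ev: "s' ''off'' (s' ''v'' 0 + 1) - s' ''e'' 0 = 0" by fastforce
    then have s': "search_state m D (Q @ R) s'" "r \<le> length (nb v)" "s' ''e'' 0 = base + r"
      "set (take r (nb v)) \<subseteq> set (Q @ R)" "s' ''v'' = s ''v''" "s' ''h'' = s ''h''" "s' ''i'' = s ''i''"
      unfolding I_def by auto
    have "length (nb v) \<le> r" using ev s' search_stateD(6)[OF s'(1)] sv base by simp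
    then have "{k. {v, k} \<in> E} \<subseteq> set (Q @ R)" using s'(4) nbv by simp
    then show ?case using s' t by (intro exI[of _ R]) simp
  qed
qed

lemma list_memory_approximates:
  assumes nb: "adjacency_lists n E nb"
  shows "approximates_within 2 (schedule scan_lists) (list_memory n nb p) (800 * (n + card E + 1)) n E p"
proof -
  let ?m = "list_memory n nb p"
  have m: "job_data ?m" unfolding job_data_def list_memory_def job_memory_def Let_def by simp
  have "scans scan_lists (\<lambda>j. length (nb j)) ?m"
  proof (rule scans_scan_lists[OF m nb])
    fix j r assume "j < n" "r < length (nb j)"
    then show "?m ''adj'' ((\<Sum>i<j. length (nb i)) + r) = nb j ! r"
      using nth_concat_map_upt[of j n r nb] unfolding list_memory_def Let_def
      by (simp del: length_concat)
  qed (simp add: list_memory_def Let_def)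
  \<comment> \<open>Memory is zero outside the input, which is the invariant for empty
    \<open>D\<close> and \<open>Q\<close>; \<open>pw\<close> and \<open>U\<close> both
    vanish.\<close>
  moreover have "search_state ?m {} [] ?m"
    unfolding search_state_def optimal_on_def rigid_on_def list_memory_def job_memory_def Let_def by simp
  ultimately have "wp (schedule scan_lists) (\<lambda>t s'. t \<le> 400 * (n + (\<Sum>j<n. length (nb j)) + 1) \<and>
    feasible n E (s' ''out'') \<and> makespan n p (s' ''out'') \<le> 2 * opt_makespan n E p) ?m"
    by (rule wp_schedule[OF _ _ m]) (simp add: list_memory_def job_memory_def Let_def)
  then show ?thesis
    using sum_length_adjacency_lists[OF nb] unfolding approximates_within_def wp_def by fastforce
qed

end

section \<open>Bit matrices\<close>

text \<open>Adding a power not yet present causes no carry and is thus bitwise disjunction: such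
  sums are the bit vectors of finite sets.\<close>

lemma bit_sum_exp:
  assumes "finite A" shows "bit (\<Sum>j\<in>A. 2 ^ j :: nat) k \<longleftrightarrow> k \<in> A"
  using assms
proof (induction A arbitrary: k rule: finite_induct)
  case (insert x F)
  have "Bit_Operations.and (2 ^ x) (\<Sum>j\<in>F. 2 ^ j :: nat) = 0"
    by (rule bit_eqI) (use insert in \<open>auto simp: bit_and_iff bit_exp_iff\<close>)
  then have "(\<Sum>j\<in>insert x F. 2 ^ j :: nat) = Bit_Operations.or (2 ^ x) (\<Sum>j\<in>F. 2 ^ j)"
    using insert by (simp add: disjunctive_add_eq_or)
  then show ?case using insert by (auto simp: bit_or_iff bit_exp_iff)
qed simp

lemma and_sum_exp:
  assumes "finite A" "finite B"
  shows "Bit_Operations.and (\<Sum>j\<in>A. 2 ^ j) (\<Sum>j\<in>B. 2 ^ j) = (\<Sum>j\<in>A \<inter> B. 2 ^ j :: nat)"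
  by (rule bit_eqI) (use assms in \<open>simp add: bit_and_iff bit_sum_exp\<close>)

lemma floor_log_sum_exp:
  assumes "finite A" "A \<noteq> {}"
  shows "floor_log (\<Sum>j\<in>A. 2 ^ j) = Max A"
proof (rule floor_log_eqI)
  have "2 ^ Max A = (\<Sum>j\<in>{Max A}. 2 ^ j :: nat)" by simp
  also have "\<dots> \<le> (\<Sum>j\<in>A. 2 ^ j)" by (rule sum_mono2) (use assms in auto)
  finally show *: "2 ^ Max A \<le> (\<Sum>j\<in>A. 2 ^ j :: nat)" .
  show "(\<Sum>j\<in>A. 2 ^ j :: nat) > 0" using order.strict_trans2[OF _ *] by simp
  have "(\<Sum>j\<in>A. 2 ^ j :: nat) \<le> (\<Sum>j<Suc (Max A). 2 ^ j)"
    by (rule sum_mono2) (use assms in \<open>auto simp: less_Suc_eq_le\<close>)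
  also have "\<dots> < 2 * 2 ^ Max A"
    using sum_power2[of "Suc (Max A)"] by (simp add: atLeast0LessThan)
  finally show "(\<Sum>j\<in>A. 2 ^ j :: nat) < 2 * 2 ^ Max A" .
qed

text \<open>The machine has no shift, so the power belonging to a bit position found by
  \<open>Log\<close> must be looked up; the table is built by doubling.\<close>

definition init_matrix :: com where
  "init_matrix =
     Store ''pw'' (Const 0) (Const 1) ;;
     While (Sub (var ''n'') (var ''k''))
       (''U'' ::= Add (var ''U'') (Cell ''pw'' (var ''k'')) ;;
        Store ''pw'' (Add (var ''k'') (Const 1))
          (Add (Cell ''pw'' (var ''k'')) (Cell ''pw'' (var ''k''))) ;;
        ''k'' ::= Add (var ''k'') (Const 1))"

definition scan_matrix :: com where
  "scan_matrix =
     ''W'' ::= And (Cell ''N'' (var ''v'')) (var ''U'') ;;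
     While (var ''W'')
       (''k'' ::= Log (var ''W'') ;;
        ''W'' ::= Sub (var ''W'') (Cell ''pw'' (var ''k'')) ;;
        enqueue)"

lemma wp_init_matrix:
  assumes "s ''n'' 0 = n" "s ''k'' 0 = 0" "s ''U'' 0 = 0"
  shows "wp init_matrix (\<lambda>t s'. t \<le> 40 * n + 9 \<and> (\<forall>j<n. s' ''pw'' j = 2 ^ j) \<and>
    s' ''U'' 0 = (\<Sum>j<n. 2 ^ j) \<and> (\<forall>x. x \<notin> {''pw'', ''U'', ''k''} \<longrightarrow> s' x = s x)) s"
proof -
  \<comment> \<open>The table runs one entry ahead of the mask, because each round makes the next
    power from the current one: hence \<open>j \<le> k\<close> against \<open>j < k\<close>.\<close>
  define I where "I k s' \<longleftrightarrow> k \<le> n \<and> s' ''k'' 0 = k \<and> (\<forall>j\<le>k. s' ''pw'' j = 2 ^ j) \<and>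
    s' ''U'' 0 = (\<Sum>j<k. 2 ^ j) \<and> (\<forall>x. x \<notin> {''pw'', ''U'', ''k''} \<longrightarrow> s' x = s x)"
    for k and s' :: memory
  show ?thesis
    unfolding init_matrix_def
  proof (rule wp_Seq, rule wp_Store, rule wp_mono[OF wp_While[where I = I and
          \<Phi> = "\<lambda>k. 40 * (n - k)", of _ _ 0]], goal_cases)
    case (1 k r)
    then have r: "k < n" "r ''k'' 0 = k" "r ''U'' 0 = (\<Sum>j<k. 2 ^ j)"
      and pw: "\<And>j. j \<le> k \<Longrightarrow> r ''pw'' j = 2 ^ j"
      and eq: "\<And>x. x \<notin> {''pw'', ''U'', ''k''} \<Longrightarrow> r x = s x"
      using assms unfolding I_def by auto
    show ?case
      by (intro wp_Seq wp_Store exI[of _ "Suc k"] conjI)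
        (use r pw eq in \<open>auto simp: I_def le_Suc_eq\<close>)
  next
    case 2
    show ?case using assms by (simp add: I_def)
  next
    case (3 t s')
    then obtain k where k: "I k s'" "s' ''n'' 0 - s' ''k'' 0 = 0" "t \<le> 40 * n + 6" by fastforce
    moreover from k(1) have "s' ''n'' = s ''n''" unfolding I_def by simp
    ultimately have "k = n" using assms unfolding I_def by simp
    then show ?case using k unfolding I_def by simp
  qed
qed

context job_graph
begin

text \<open>One conjunction discards all visited neighbours of \<open>v\<close>, so edges to them
  cost nothing individually. The loop is charged to the jobs found: 3 + 5 + 8 steps and at most 50
  for \<open>enqueue\<close>, rounded up to 80 each.\<close>

lemma scans_scan_matrix:
  assumes m: "job_data m" and N: "\<And>j. m ''N'' j = (\<Sum>k | k < n \<and> {j, k} \<in> E. 2 ^ k)"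
    and pw: "\<And>j. j < n \<Longrightarrow> m ''pw'' j = 2 ^ j"
  shows "scans scan_matrix (\<lambda>_. 0) m"
  unfolding scans_def
proof (intro allI impI)
  fix D Q s v
  assume st: "search_state m D Q s" and v: "v \<in> set Q" and sv: "s ''v'' 0 = v"
    and c: "s ''c'' 0 = 3 - s ''out'' v"
  note st' = search_stateD[OF st]
  define nb where "nb = {k. {v, k} \<in> E}"
  have nb: "nb \<subseteq> {..<n}" using edge_bounds unfolding nb_def by blast
  then have fin: "finite nb" using finite_subset by blast
  have "{k. k < n \<and> {v, k} \<in> E} \<inter> ({..<n} - D - set Q) = nb - set Q"
    using nb neighbour_not_done[OF st v] unfolding nb_def by blast
  moreover have "(\<Sum>j\<in>{..<n} - D - set Q. m ''pw'' j) = (\<Sum>j\<in>{..<n} - D - set Q. 2 ^ j)"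
    by (rule sum.cong) (auto simp: pw)
  ultimately have W: "Bit_Operations.and (m ''N'' v) (s ''U'' 0) = (\<Sum>j\<in>nb - set Q. 2 ^ j)"
    unfolding N st'(18) by (simp add: and_sum_exp)
  \<comment> \<open>The cardinality equation converts time counted in extracted bits into time
    counted in \<open>length R\<close>.\<close>
  define I where "I = (\<lambda>R s'. search_state m D (Q @ R) s' \<and>
    s' ''W'' 0 = (\<Sum>j\<in>nb - set (Q @ R). 2 ^ j) \<and>
    card (nb - set (Q @ R)) + length R = card (nb - set Q) \<and>
    s' ''v'' = s ''v'' \<and> s' ''c'' = s ''c'' \<and> s' ''h'' = s ''h'' \<and> s' ''i'' = s ''i'' \<and>
    s' ''out'' v = s ''out'' v)"
  define s1 where "s1 = s(''W'' := (s ''W'')(0 := \<Sum>j\<in>nb - set Q. 2 ^ j))"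
  have "search_state m D Q s1" by (rule search_state_cong[OF st]) (auto simp: s1_def)
  then have I0: "I [] s1" unfolding I_def by (simp add: s1_def)
  show "wp scan_matrix (\<lambda>t s'. \<exists>R. search_state m D (Q @ R) s' \<and> {k. {v, k} \<in> E} \<subseteq> set (Q @ R) \<and>
       s' ''h'' = s ''h'' \<and> s' ''i'' = s ''i'' \<and> t \<le> 100 * (1 + 0 + length R)) s"
    unfolding scan_matrix_def
  proof (rule wp_Seq, rule wp_Store, rule wp_mono[OF wp_While[where I = I and
          \<Phi> = "\<lambda>R. 80 * card (nb - set (Q @ R))", of _ _ "[]"]], goal_cases)
    case (1 R r0)
    have r0: "search_state m D (Q @ R) r0" "r0 ''W'' 0 = (\<Sum>j\<in>nb - set (Q @ R). 2 ^ j)"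
      "card (nb - set (Q @ R)) + length R = card (nb - set Q)"
      "r0 ''v'' = s ''v''" "r0 ''c'' = s ''c''" "r0 ''h'' = s ''h''" "r0 ''i'' = s ''i''"
      "r0 ''out'' v = s ''out'' v" using 1(1) unfolding I_def by auto
    note r0' = search_stateD[OF r0(1)]
    define S where "S = nb - set (Q @ R)"
    have S: "finite S" "S \<noteq> {}" using fin 1(2) r0(2) unfolding S_def by auto
    define k where "k = Max S"
    have kS: "k \<in> S" using S unfolding k_def by simp
    then have k: "{v, k} \<in> E" "k \<notin> set (Q @ R)" "k < n" using nb unfolding S_def nb_def by auto
    have W0: "r0 ''W'' 0 = (\<Sum>j\<in>S. 2 ^ j)" using r0(2) unfolding S_def .
    have W1: "r0 ''W'' 0 - 2 ^ k = (\<Sum>j\<in>S - {k}. 2 ^ j)"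
      using kS S by (simp add: W0 sum_diff1_nat)
    have log: "floor_log (r0 ''W'' 0) = k" unfolding W0 k_def by (rule floor_log_sum_exp[OF S])
    define r1 where "r1 = r0(''k'' := (r0 ''k'')(0 := k), ''W'' := (r0 ''W'')(0 := \<Sum>j\<in>S - {k}. 2 ^ j))"
    have r1: "search_state m D (Q @ R) r1" by (rule search_state_cong[OF r0(1)]) (auto simp: r1_def)
    have r1x: "r1 ''W'' 0 = (\<Sum>j\<in>S - {k}. 2 ^ j)" "r1 ''v'' = s ''v''" "r1 ''c'' = s ''c''"
      "r1 ''h'' = s ''h''" "r1 ''i'' = s ''i''" "r1 ''out'' v = s ''out'' v" "r1 ''k'' 0 = k"
      using r0 by (auto simp: r1_def)
    have vQ: "v \<in> set (Q @ R)" using v by simp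
    have c1: "r1 ''c'' 0 = 3 - r1 ''out'' v" using c r1x by simp
    have S': "nb - set (Q @ R @ [k]) = S - {k}" unfolding S_def by auto
    have card: "card S = Suc (card (S - {k}))" using kS S by (metis card_Suc_Diff1)
    have "wp enqueue (\<lambda>t s'. I (R @ [k]) s' \<and> t \<le> 50) r1"
      by (rule wp_mono[OF wp_enqueue_neighbour[OF r1 m vQ k(1,2) r1x(7) c1]])
        (unfold I_def S', use r1x r0(3)[folded S_def] card in simp)
    moreover have "r0(''k'' := (r0 ''k'')(0 := k), ''W'' := (r0 ''W'')(0 := r0 ''W'' 0 - 2 ^ k)) = r1"
      unfolding r1_def W1 ..
    ultimately show ?case
      apply -
      apply (rule wp_Seq, rule wp_Store)+
      apply (simp add: log r0'(4) pw k(3))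
      apply (erule wp_mono)
      subgoal for t s' using card unfolding S'[symmetric] unfolding S_def
        by (intro exI[of _ "R @ [k]"]) simp
      done
  next
    case 2
    then show ?case using I0 st'(5) sv W by (simp add: s1_def)
  next
    case (3 t s')
    then obtain R where I: "I R s'" and t: "t + 80 * card (nb - set (Q @ R)) \<le> 80 * card (nb - set Q) + 3"
      and ev: "s' ''W'' 0 = 0" by fastforce
    then have s': "search_state m D (Q @ R) s'" "s' ''W'' 0 = (\<Sum>j\<in>nb - set (Q @ R). 2 ^ j)"
      "card (nb - set (Q @ R)) + length R = card (nb - set Q)" "s' ''h'' = s ''h''" "s' ''i'' = s ''i''"
      unfolding I_def by auto
    have "nb - set (Q @ R) = {}" using ev s'(2) fin by auto
    then show ?case using s' t by (intro exI[of _ R]) (auto simp: nb_def)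
  qed
qed

lemma matrix_memory_approximates:
  "approximates_within 2 (init_matrix ;; schedule scan_matrix) (matrix_memory n E p) (800 * (n + 1)) n E p"
proof -
  let ?m = "matrix_memory n E p"
  have "wp (init_matrix ;; schedule scan_matrix) (\<lambda>t s'. t \<le> 800 * (n + 1) \<and>
    feasible n E (s' ''out'') \<and> makespan n p (s' ''out'') \<le> 2 * opt_makespan n E p) ?m"
  proof (rule wp_Seq, rule wp_mono[OF wp_init_matrix[of ?m n]], goal_cases)
    case (4 t s)
    then have s: "t \<le> 40 * n + 9" "\<And>j. j < n \<Longrightarrow> s ''pw'' j = 2 ^ j" "s ''U'' 0 = (\<Sum>j<n. 2 ^ j)"
      "\<And>x. x \<notin> {''pw'', ''U'', ''k''} \<Longrightarrow> s x = ?m x" by auto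
    have sd: "job_data s" unfolding job_data_def by (simp add: s(4) matrix_memory_def job_memory_def)
    have "scans scan_matrix (\<lambda>_. 0) s"
      by (rule scans_scan_matrix[OF sd]) (simp_all add: s(2,4) matrix_memory_def)
    \<comment> \<open>The reference memory is the one after initialisation, since \<open>pw\<close>
      is written there and never again.\<close>
    moreover have "search_state s {} [] s"
      unfolding search_state_def optimal_on_def rigid_on_def
      by (simp add: s(2,3,4) matrix_memory_def job_memory_def)
    ultimately show ?case
      by (rule wp_mono[OF wp_schedule[OF _ _ sd]])
        (use s(1) in \<open>auto simp: s(4) matrix_memory_def job_memory_def\<close>)
  qed (auto simp: matrix_memory_def job_memory_def)
  then show ?thesis unfolding approximates_within_def wp_def by blast
qed

end

lemma linear_bigo: "(\<lambda>m. real (800 * (m + 1))) \<in> O(\<lambda>m. real m)"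
proof (rule bigoI)
  show "\<forall>\<^sub>F m in at_top. norm (real (800 * (m + 1))) \<le> 1600 * norm (real m)"
    using eventually_ge_at_top[of 1] by eventually_elim simp
qed

text \<open>With bit rows the input has about \<open>3 * n\<close> words, so time linear in
  \<open>n\<close> is possible although |E| may be quadratic. With adjacency lists the input itself
  has size of order n + |E|, and additive instructions suffice.\<close>

theorem theorem21:
  shows "(\<exists>P T. (\<lambda>n. real (T n)) \<in> O(\<lambda>n. real n) \<and>
            (\<forall>n E p. bipartite_instance n E \<longrightarrow>
               approximates_within 2 P (matrix_memory n E p) (T n) n E p)) \<and>
         (\<exists>P T. additive_com P \<and> (\<lambda>m. real (T m)) \<in> O(\<lambda>m. real m) \<and>
            (\<forall>n E p nb. bipartite_instance n E \<longrightarrow> adjacency_lists n E nb \<longrightarrow>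
               approximates_within 2 P (list_memory n nb p) (T (n + card E)) n E p))"
proof (intro conjI exI allI impI)
  fix n E p assume "bipartite_instance n E"
  then interpret job_graph n E p by unfold_locales
  show "approximates_within 2 (init_matrix ;; schedule scan_matrix) (matrix_memory n E p)
      (800 * (n + 1)) n E p"
    by (rule matrix_memory_approximates)
next
  fix n E p nb assume "bipartite_instance n E" and nb: "adjacency_lists n E nb"
  then interpret job_graph n E p by unfold_locales
  show "approximates_within 2 (schedule scan_lists) (list_memory n nb p)
      (800 * (n + card E + 1)) n E p"
    by (rule list_memory_approximates[OF nb])
qed (rule linear_bigo additive_schedule_scan_lists)+

end
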